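(* Let $-1<\alpha<0<\beta$ and let $n\geqslant5$ be an integer. Then the zeros of $\phi_n^{(\alpha+1,\beta+1)}(\mu)$ and $\phi_{n-2}^{(\alpha+1,\beta+1)}(\mu)$ interlace, and the zeros of $\phi_n^{(\alpha,\beta)}(\mu)$ and $\phi_{n-2}^{(\alpha,\beta)}(\mu)$ interlace.
   Context: For real $a$ and integer $m\geqslant0$, $(a)_m=a(a+1)\cdots(a+m-1)$, $(a)_0=1$. The Jacobi polynomial is $P_n^{(\alpha,\beta)}(x)=\frac{(\alpha+1)_n}{n!}\sum_{k=0}^{n}\frac{(-n)_k(n+\alpha+\beta+1)_k}{k!\,(\alpha+1)_k}\big(\frac{1-x}{2}\big)^k$, and $$\phi_n^{(\alpha,\beta)}(\mu)=\sum_{k=0}^{[n/2]}\Big(\tfrac{d^{2k}}{dx^{2k}}P_n^{(\alpha,\beta)}(x)\Big)\Big|_{x=1}\mu^k=\frac{(\alpha+1)_n}{n!}\sum_{k=0}^{[n/2]}\frac{(-n)_{2k}(n+\alpha+\beta+1)_{2k}}{(\alpha+1)_{2k}}\Big(\frac{\mu}{4}\Big)^k .$$ Two real polynomials interlace (strictly) if all their zeros are real, simple and mutually distinct, and between any two consecutive zeros of either polynomial there is exactly one zero of the other. *)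

theory Defs
  imports "HOL-Computational_Algebra.Polynomial" Complex_Main
begin

definition phi :: "nat \<Rightarrow> real \<Rightarrow> real \<Rightarrow> real poly" where
  "phi n a b = smult (pochhammer (a + 1) n / fact n)
     (\<Sum>k\<le>n div 2. monom (pochhammer (- real n) (2*k) * pochhammer (real n + a + b + 1) (2*k)
                          / pochhammer (a + 1) (2*k) * (1/4) ^ k) k)"

definition real_simple_zeros :: "real poly \<Rightarrow> bool" where
  "real_simple_zeros p \<longleftrightarrow>
     (\<forall>z::complex. poly (map_poly complex_of_real p) z = 0 \<longrightarrow>
        z \<in> \<real> \<and> order z (map_poly complex_of_real p) = 1)"

definition separates :: "real poly \<Rightarrow> real poly \<Rightarrow> bool" where
  "separates p q \<longleftrightarrow>
     (\<forall>a b. a < b \<and> poly p a = 0 \<and> poly p b = 0 \<and> (\<forall>x. a < x \<and> x < b \<longrightarrow> poly p x \<noteq> 0)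
        \<longrightarrow> card {x. a < x \<and> x < b \<and> poly q x = 0} = 1)"

definition interlace :: "real poly \<Rightarrow> real poly \<Rightarrow> bool" where
  "interlace p q \<longleftrightarrow> p \<noteq> 0 \<and> q \<noteq> 0 \<and> real_simple_zeros p \<and> real_simple_zeros q \<and>
     (\<forall>x. \<not> (poly p x = 0 \<and> poly q x = 0)) \<and> separates p q \<and> separates q p"

end

theory Submission
  imports Defs "HOL-Analysis.Gamma_Function" "HOL-Computational_Algebra.Fundamental_Theorem_Algebra"
begin

text \<open>
  Substitute \<open>t = (1 - x) / 2\<close>, let \<open>P n\<close> be the Jacobi polynomial in \<open>t\<close>, and let \<open>y n\<close> be the
  polynomial with \<open>y + i w y' = P n\<close> for \<open>w > 0\<close>. With \<open>\<mu> = - 4 w^2\<close>, the value \<open>f n = y n (0)\<close> has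
  real part \<open>phi n \<alpha> \<beta> (\<mu>)\<close> and imaginary part
  \<open>w (n + \<alpha> + \<beta> + 1) phi (n - 1) (\<alpha> + 1) (\<beta> + 1) (\<mu>)\<close>.
  The combination \<open>y = f (n - 1) y n - f n y (n - 1)\<close> vanishes at \<open>0\<close>, and
  \<open>y + i w y' = f (n - 1) P n - f n P (n - 1)\<close> is orthogonal to all polynomials of degree below
  \<open>n - 1\<close>. Testing with the conjugates of \<open>y / t\<close> and of \<open>y'\<close> and integrating by parts
  shows that \<open>f n / f (n - 1)\<close> has positive imaginary and (this is where \<open>\<alpha> \<le> 0 \<le> \<beta>\<close> is used)
  positive real part. Hence the argument of \<open>f n / f (n - 2)\<close> lies strictly between \<open>0\<close> and \<open>\<pi>\<close>.

  These signs determine the sign of one polynomial at the zeros of another; partial fractions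
  turn such sign information into reality, simplicity and interlacing of zeros.
\<close>

section \<open>Interlacing from signs at the zeros\<close>

abbreviation cpoly :: "real poly \<Rightarrow> complex poly" where
  "cpoly \<equiv> map_poly complex_of_real"

lemma cpoly_add: "cpoly (p + q) = cpoly p + cpoly q"
  by (intro poly_eqI) (simp add: coeff_map_poly)

lemma cpoly_mult: "cpoly (p * q) = cpoly p * cpoly q"
  by (intro poly_eqI) (simp add: coeff_map_poly coeff_mult)

lemma poly_cpoly_of_real: "poly (cpoly p) (of_real x) = of_real (poly p x)"
  by (simp add: poly_altdef degree_map_poly coeff_map_poly)

lemma pderiv_cpoly: "pderiv (cpoly p) = cpoly (pderiv p)"
  by (intro poly_eqI) (simp add: coeff_map_poly coeff_pderiv)

lemma cpoly_eq_0_iff: "cpoly p = 0 \<longleftrightarrow> p = 0"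
  by (simp add: map_poly_eq_0_iff)

lemma real_simple_zeros_nonzero:
  assumes "real_simple_zeros p" shows "p \<noteq> 0"
proof
  assume "p = 0"
  then have "\<i> \<in> \<real>" using assms unfolding real_simple_zeros_def by simp
  then show False by (simp add: complex_is_Real_iff)
qed

text \<open>Trades root orders for square-freeness, which can be tested by \<open>P\<close> and
  \<open>pderiv P\<close> having no common zero and which yields a factorization into distinct
  linear factors.\<close>

lemma real_simple_zeros_iff_rsquarefree:
  "real_simple_zeros p \<longleftrightarrow> (\<forall>z. poly (cpoly p) z = 0 \<longrightarrow> z \<in> \<real>) \<and> rsquarefree (cpoly p)"
proof
  assume p: "real_simple_zeros p"
  have "order z (cpoly p) = 0 \<or> order z (cpoly p) = 1" for z
    using p order_0I[of "cpoly p" z] unfolding real_simple_zeros_def by blast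
  then show "(\<forall>z. poly (cpoly p) z = 0 \<longrightarrow> z \<in> \<real>) \<and> rsquarefree (cpoly p)"
    using p real_simple_zeros_nonzero[OF p]
    unfolding real_simple_zeros_def rsquarefree_def cpoly_eq_0_iff by blast
next
  assume p: "(\<forall>z. poly (cpoly p) z = 0 \<longrightarrow> z \<in> \<real>) \<and> rsquarefree (cpoly p)"
  then have "order z (cpoly p) = 1" if "poly (cpoly p) z = 0" for z
    using rsquarefree_root_order[of "cpoly p" z] that unfolding rsquarefree_def by blast
  with p show "real_simple_zeros p" unfolding real_simple_zeros_def by blast
qed

section \<open>Partial fractions at simple complex zeros\<close>

lemma rsquarefree_card_roots:
  fixes P :: "complex poly"
  assumes "rsquarefree P" shows "card {z. poly P z = 0} = degree P"
proof -
  have P0: "P \<noteq> 0" using assms by (simp add: rsquarefree_def)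
  have "degree P = degree (smult (lead_coeff P) (\<Prod>z|poly P z = 0. [:-z, 1:]))"
    using complex_poly_decompose_rsquarefree[OF assms] by simp
  also have "\<dots> = (\<Sum>z|poly P z = 0. degree [:-z, 1:])"
    using P0 by (simp add: degree_prod_eq_sum_degree)
  finally show ?thesis by simp
qed

lemma poly_pderiv_linear_mult:
  "poly (pderiv ([:-a, 1:] * q)) x = (x - a) * poly (pderiv q) x + poly q x"
  for a :: "'a::idom"
proof -
  have "pderiv ([:-a, 1:] * q) = [:-a, 1:] * pderiv q + q * [:1:]"
    by (simp only: pderiv_mult pderiv_pCons) simp
  then show ?thesis by (simp only:) (simp add: algebra_simps)
qed

lemma pderiv_at_simple_root:
  fixes P :: "complex poly"
  assumes "rsquarefree P" and y: "poly P y = 0"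
  shows "poly (pderiv P) y = lead_coeff P * (\<Prod>u\<in>{z. poly P z = 0} - {y}. y - u)"
proof -
  let ?Z = "{z. poly P z = 0}"
  have fin: "finite ?Z" using assms(1) by (intro poly_roots_finite) (simp add: rsquarefree_def)
  let ?Q = "smult (lead_coeff P) (\<Prod>u\<in>?Z - {y}. [:-u, 1:])"
  have "P = smult (lead_coeff P) (\<Prod>u\<in>?Z. [:-u, 1:])"
    using complex_poly_decompose_rsquarefree[OF assms(1)] by simp
  also have "\<dots> = [:-y, 1:] * ?Q"
    using fin y by (subst prod.remove[of _ y]) auto
  finally have "poly (pderiv P) y = poly (pderiv ([:-y, 1:] * ?Q)) y" by (rule arg_cong)
  also have "\<dots> = poly ?Q y" unfolding poly_pderiv_linear_mult by simp
  finally show ?thesis by (simp add: poly_prod)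
qed

text \<open>Lagrange interpolation at the zeros of \<open>P\<close>: there are
  \<open>degree P\<close> of them, so a polynomial of smaller degree is determined by its values
  there.\<close>

lemma partial_fraction:
  fixes P R :: "complex poly"
  assumes P: "rsquarefree P" and R: "R = 0 \<or> degree R < degree P" and x: "poly P x \<noteq> 0"
  shows "poly R x = poly P x * (\<Sum>y|poly P y = 0. poly R y / poly (pderiv P) y / (x - y))"
proof -
  let ?Z = "{z. poly P z = 0}"
  let ?l = "lead_coeff P"
  have P0: "P \<noteq> 0" using P by (simp add: rsquarefree_def)
  have fin: "finite ?Z" using P0 by (rule poly_roots_finite)
  have card: "card ?Z = degree P" by (rule rsquarefree_card_roots[OF P])
  \<comment> \<open>\<open>w y\<close> is the residue of \<open>R / P\<close> at \<open>y\<close>,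
    and \<open>T\<close> is the interpolant: its summand for \<open>y\<close> vanishes at every
    other zero and equals \<open>w y * P'(y)\<close> at \<open>y\<close>.\<close>
  define w where "w y = poly R y / poly (pderiv P) y" for y
  define T where "T = (\<Sum>y\<in>?Z. smult (?l * w y) (\<Prod>u\<in>?Z - {y}. [:-u, 1:]))"
  have pd: "poly (pderiv P) y \<noteq> 0" if "y \<in> ?Z" for y
    using P that by (auto simp: rsquarefree_roots)
  have "T = R"
  proof (cases "?Z = {}")
    case True
    then have "degree P = 0" using card by (metis card.empty)
    with R have "R = 0" by auto
    with True show ?thesis unfolding T_def True by simp
  next
    case False
    then have pos: "degree P > 0" using card fin by (metis card_gt_0_iff)
    show ?thesis
    proof (rule poly_eqI_degree[of ?Z])
      show "degree R < card ?Z" using R pos card by auto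
      show "degree T < card ?Z"
        unfolding T_def
      proof (rule degree_sum_less)
        fix y assume y: "y \<in> ?Z"
        have "degree (smult (?l * w y) (\<Prod>u\<in>?Z - {y}. [:-u, 1:])) \<le> degree (\<Prod>u\<in>?Z - {y}. [:-u, 1:])"
          by (rule degree_smult_le)
        also have "\<dots> = card (?Z - {y})"
          by (simp add: degree_prod_eq_sum_degree)
        also have "\<dots> < card ?Z" using y fin by (metis card_Diff1_less)
        finally show "degree (smult (?l * w y) (\<Prod>u\<in>?Z - {y}. [:-u, 1:])) < card ?Z" .
      qed (use pos card in simp)
      fix z assume z: "z \<in> ?Z"
      have "poly T z = (\<Sum>y\<in>?Z. ?l * w y * (\<Prod>u\<in>?Z - {y}. z - u))"
        by (simp add: T_def poly_sum poly_prod)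
      also have "\<dots> = (\<Sum>y\<in>?Z. if y = z then ?l * w z * (\<Prod>u\<in>?Z - {z}. z - u) else 0)"
      proof (rule sum.cong[OF refl])
        fix y assume "y \<in> ?Z"
        show "?l * w y * (\<Prod>u\<in>?Z - {y}. z - u) = (if y = z then ?l * w z * (\<Prod>u\<in>?Z - {z}. z - u) else 0)"
        proof (cases "y = z")
          case False
          then have "(\<Prod>u\<in>?Z - {y}. z - u) = 0"
            using z fin by (intro prod_zero) auto
          then show ?thesis using False by simp
        qed simp
      qed
      also have "\<dots> = w z * poly (pderiv P) z"
        using z fin pderiv_at_simple_root[OF P, of z] by simp
      also have "\<dots> = poly R z" using pd[OF z] by (simp add: w_def)
      finally show "poly T z = poly R z" .
    qed
  qed
  have Px: "poly P x = ?l * (\<Prod>u\<in>?Z. x - u)"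
  proof -
    have "poly P x = poly (smult ?l (\<Prod>u\<in>?Z. [:-u, 1:])) x"
      by (simp only: complex_poly_decompose_rsquarefree[OF P])
    then show ?thesis by (simp add: poly_prod)
  qed
  have "poly R x = (\<Sum>y\<in>?Z. ?l * w y * (\<Prod>u\<in>?Z - {y}. x - u))"
    unfolding \<open>T = R\<close>[symmetric] by (simp add: T_def poly_sum poly_prod)
  also have "\<dots> = (\<Sum>y\<in>?Z. poly P x * (w y / (x - y)))"
  proof (rule sum.cong[OF refl])
    fix y assume y: "y \<in> ?Z"
    then have "x - y \<noteq> 0" using x by auto
    moreover have "poly P x = ?l * ((x - y) * (\<Prod>u\<in>?Z - {y}. x - u))"
      unfolding Px using fin y by (subst prod.remove[of _ y]) auto
    ultimately show "?l * w y * (\<Prod>u\<in>?Z - {y}. x - u) = poly P x * (w y / (x - y))" by simp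
  qed
  finally show ?thesis by (simp add: sum_distrib_left w_def)
qed

text \<open>
  The sign condition makes all residues of \<open>g / p\<close> negative, so \<open>g / p\<close> maps the upper half-plane to
  itself and increases along the real line; hence all zeros of \<open>g\<close> are real and simple.
\<close>

lemma interlacing_transfer:
  fixes p g :: "real poly"
  assumes p: "real_simple_zeros p" and g0: "g \<noteq> 0"
    and sgn: "\<And>y. poly p y = 0 \<Longrightarrow> poly (pderiv p) y * poly g y < 0"
    and deg: "degree g \<le> degree p \<or> degree g = Suc (degree p) \<and> 0 < lead_coeff p * lead_coeff g"
  shows "real_simple_zeros g"
    and "\<And>z. poly g z = 0 \<Longrightarrow> 0 < poly (pderiv g) z * poly p z"
proof -
  have p0: "p \<noteq> 0" using p by (rule real_simple_zeros_nonzero)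
  let ?Z = "{z. poly (cpoly p) z = 0}"
  have sqf: "rsquarefree (cpoly p)" using p by (simp add: real_simple_zeros_iff_rsquarefree)
  have fin: "finite ?Z" using p0 by (intro poly_roots_finite) (simp add: cpoly_eq_0_iff)
  have card: "card ?Z = degree p"
    using rsquarefree_card_roots[OF sqf] by (simp add: degree_map_poly)
  \<comment> \<open>Division splits \<open>g / p\<close> into a polynomial part, of degree at most 1
    by the degree assumption, and a remainder \<open>r / p\<close> with simple poles.\<close>
  define q where "q = g div p"
  define r where "r = g mod p"
  define c where "c = coeff q 0"
  define L where "L = coeff q 1"
  have gqr: "g = p * q + r" by (simp add: q_def r_def)
  have r: "r = 0 \<or> degree r < degree p"
    unfolding r_def using p0 degree_mod_less by blast
  have degq': "degree q \<le> degree g - degree p"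
  proof (cases "q = 0")
    case False
    have "degree p + degree q = degree (g - r)"
      using p0 False by (simp add: gqr degree_mult_eq)
    also have "\<dots> \<le> max (degree g) (degree r)" by (rule degree_diff_le_max)
    finally show ?thesis using r False by auto
  qed simp
  with deg have degq: "degree q \<le> 1" by linarith
  then have q: "q = [:c, L:]"
    by (intro poly_eqI) (auto simp: c_def L_def coeff_pCons coeff_eq_0 split: nat.split)
  have L: "L \<ge> 0"
  proof (cases "degree g \<le> degree p")
    case True
    with degq' have "degree q = 0" by simp
    then show ?thesis by (simp add: L_def coeff_eq_0)
  next
    case False
    with deg have d: "degree g = Suc (degree p)" and l: "0 < lead_coeff p * lead_coeff g" by auto
    have "coeff g (Suc (degree p)) = coeff (p * q) (Suc (degree p))"
      unfolding gqr using r by (auto simp: coeff_eq_0)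
    also have "\<dots> = lead_coeff p * L"
      unfolding q by (simp add: coeff_pCons coeff_eq_0)
    finally have "lead_coeff g = lead_coeff p * L" using d by simp
    with l have "0 < (lead_coeff p)\<^sup>2 * L" by (simp add: power2_eq_square mult.assoc)
    then show ?thesis by (simp add: zero_less_mult_iff)
  qed
  \<comment> \<open>The residue of \<open>g / p\<close> at the pole \<open>y\<close>, which is real;
    \<open>g\<close> and \<open>r\<close> agree at the zeros of \<open>p\<close>.\<close>
  define w where "w y = poly g (Re y) / poly (pderiv p) (Re y)" for y
  have w: "w y < 0" "Im y = 0" "poly p (Re y) = 0" "poly (cpoly g) y \<noteq> 0"
    "poly (cpoly r) y / poly (pderiv (cpoly p)) y = of_real (w y)" if "y \<in> ?Z" for y
  proof -
    have "y \<in> \<real>" using p that unfolding real_simple_zeros_def by auto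
    then obtain x where y: "y = of_real x" by (auto elim: Reals_cases)
    have px: "poly p x = 0" using that unfolding y by (simp add: poly_cpoly_of_real)
    then show "poly p (Re y) = 0" by (simp add: y)
    from sgn[OF px] show "w y < 0"
      unfolding w_def y by (auto simp: divide_less_0_iff mult_less_0_iff)
    show "Im y = 0" by (simp add: y)
    show "poly (cpoly g) y \<noteq> 0" unfolding y poly_cpoly_of_real using sgn[OF px] by auto
    have "poly g x = poly r x" unfolding gqr using px by simp
    then show "poly (cpoly r) y / poly (pderiv (cpoly p)) y = of_real (w y)"
      unfolding w_def pderiv_cpoly y poly_cpoly_of_real by simp
  qed
  \<comment> \<open>\<open>H\<close> is \<open>g / p\<close> written in partial fractions.\<close>
  define H where "H x = of_real c + of_real L * x + (\<Sum>y\<in>?Z. of_real (w y) / (x - y))" for x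
  have GH: "poly (cpoly g) x = poly (cpoly p) x * H x" if "poly (cpoly p) x \<noteq> 0" for x
  proof -
    have "poly (cpoly g) x = poly (cpoly p) x * poly (cpoly q) x + poly (cpoly r) x"
      unfolding gqr by (simp add: cpoly_add cpoly_mult)
    also have "poly (cpoly q) x = of_real c + of_real L * x"
      unfolding q by (simp add: map_poly_pCons mult.commute)
    also have "poly (cpoly r) x = poly (cpoly p) x * (\<Sum>y\<in>?Z. poly (cpoly r) y / poly (pderiv (cpoly p)) y / (x - y))"
      using r by (intro partial_fraction[OF sqf _ that]) (auto simp: degree_map_poly)
    also have "(\<Sum>y\<in>?Z. poly (cpoly r) y / poly (pderiv (cpoly p)) y / (x - y)) = (\<Sum>y\<in>?Z. of_real (w y) / (x - y))"
      by (intro sum.cong refl) (simp add: w(5))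
    finally show ?thesis by (simp add: H_def algebra_simps)
  qed
  \<comment> \<open>Used twice: with \<open>v y = 1 / |z - y|^2\<close> this is the factor of
    \<open>Im z\<close> in \<open>Im (H z)\<close>, with \<open>v y = 1 / (z - y)^2\<close> it is
    the derivative of \<open>H\<close> at a real zero. If \<open>p\<close> has no zeros, then
    \<open>H\<close> is \<open>c + L x\<close>, and \<open>L = 0\<close> would make \<open>g\<close>
    vanish.\<close>
  have pos: "0 < L + (\<Sum>y\<in>?Z. - w y * v y)"
    if v: "\<And>y. y \<in> ?Z \<Longrightarrow> 0 < v y" and z: "H z = 0" for v z
  proof (cases "?Z = {}")
    case True
    then have "degree p = 0" using card by (metis card.empty)
    with r have "r = 0" by auto
    have "L \<noteq> 0"
    proof
      assume "L = 0"
      with z True have "c = 0" by (simp add: H_def)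
      with \<open>L = 0\<close> \<open>r = 0\<close> gqr q g0 show False by simp
    qed
    with L True show ?thesis unfolding True by simp
  next
    case False
    have "0 < (\<Sum>y\<in>?Z. - w y * v y)"
      using fin False by (rule sum_pos) (use v w(1) in \<open>auto simp: mult_neg_pos\<close>)
    with L show ?thesis by linarith
  qed
  have root: "H z = 0" "poly (cpoly p) z \<noteq> 0" if "poly (cpoly g) z = 0" for z
  proof -
    show "poly (cpoly p) z \<noteq> 0" using that w(4)[of z] by auto
    with GH[OF this] that show "H z = 0" by simp
  qed
  have real: "z \<in> \<real>" if "poly (cpoly g) z = 0" for z
  proof -
    have "Im (H z) = L * Im z + (\<Sum>y\<in>?Z. - w y * (1 / (cmod (z - y))\<^sup>2) * Im z)"
    proof -
      have "Im (of_real (w y) / (z - y)) = - w y * (1 / (cmod (z - y))\<^sup>2) * Im z" if "y \<in> ?Z" for y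
      proof -
        show ?thesis using w(2)[OF that] by (simp add: Im_divide cmod_power2)
      qed
      then show ?thesis by (simp add: H_def Im_sum)
    qed
    also have "\<dots> = Im z * (L + (\<Sum>y\<in>?Z. - w y * (1 / (cmod (z - y))\<^sup>2)))"
      by (simp only: distrib_left sum_distrib_left) (simp add: mult_ac)
    finally have "Im z * (L + (\<Sum>y\<in>?Z. - w y * (1 / (cmod (z - y))\<^sup>2))) = 0"
      using root(1)[OF that] by simp
    moreover have "0 < L + (\<Sum>y\<in>?Z. - w y * (1 / (cmod (z - y))\<^sup>2))"
      using root[OF that] by (intro pos) auto
    ultimately show "z \<in> \<real>" by (simp add: complex_is_Real_iff)
  qed
  show dpos: "0 < poly (pderiv g) z * poly p z" if z: "poly g z = 0" for z
  proof -
    let ?x = "complex_of_real z"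
    have gz: "poly (cpoly g) ?x = 0" using z by (simp add: poly_cpoly_of_real)
    note rt = root[OF gz]
    let ?D = "L + (\<Sum>y\<in>?Z. - w y * (1 / (z - Re y)\<^sup>2))"
    have ne: "z \<noteq> Re y" "?x - y \<noteq> 0" if "y \<in> ?Z" for y
    proof -
      show "?x - y \<noteq> 0" using that rt(2) by auto
      then show "z \<noteq> Re y" using w(2)[OF that] by (auto simp: complex_eq_iff)
    qed
    have "((\<lambda>x. of_real c + of_real L * x + (\<Sum>y\<in>?Z. of_real (w y) / (x - y))) has_field_derivative 
            (of_real L + (\<Sum>y\<in>?Z. - of_real (w y) / (?x - y)\<^sup>2))) (at ?x)"
      by (auto intro!: derivative_eq_intros sum.cong ne(2) simp: power2_eq_square)
    also have "(\<lambda>x. of_real c + of_real L * x + (\<Sum>y\<in>?Z. of_real (w y) / (x - y))) = H"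
      by (simp add: H_def fun_eq_iff)
    also have "of_real L + (\<Sum>y\<in>?Z. - of_real (w y) / (?x - y)\<^sup>2) = (of_real ?D :: complex)"
    proof -
      have "- of_real (w y) / (?x - y)\<^sup>2 = (of_real (- w y * (1 / (z - Re y)\<^sup>2)) :: complex)" if "y \<in> ?Z" for y
      proof -
        have "?x - y = of_real (z - Re y)" using w(2)[OF that] by (simp add: complex_eq_iff)
        then show ?thesis by (simp only:) simp
      qed
      then have "(\<Sum>y\<in>?Z. - of_real (w y) / (?x - y)\<^sup>2) = (\<Sum>y\<in>?Z. of_real (- w y * (1 / (z - Re y)\<^sup>2)) :: complex)"
        by (rule sum.cong[OF refl])
      then show ?thesis by (simp only: of_real_add of_real_sum)
    qed
    finally have dH: "(H has_field_derivative of_real ?D) (at ?x)" .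
    have "((\<lambda>x. poly (cpoly p) x * H x) has_field_derivative poly (cpoly p) ?x * of_real ?D) (at ?x)"
      using DERIV_mult[OF poly_DERIV[of "cpoly p" ?x] dH] rt(1) by (simp add: mult.commute)
    \<comment> \<open>The identity \<open>g = p H\<close> holds only off the zeros of
      \<open>p\<close>, but these stay away from \<open>z\<close>, so it can be differentiated
      there.\<close>
    moreover have "\<forall>\<^sub>F x in nhds ?x. poly (cpoly g) x = poly (cpoly p) x * H x"
    proof -
      have "open (- ?Z)" using fin by (intro open_Compl finite_imp_closed)
      then have "\<forall>\<^sub>F x in nhds ?x. x \<in> - ?Z" using rt(2) by (intro eventually_nhds_in_open) auto
      then show ?thesis by eventually_elim (auto intro: GH)
    qed
    ultimately have "(poly (cpoly g) has_field_derivative poly (cpoly p) ?x * of_real ?D) (at ?x)"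
      using DERIV_cong_ev[of ?x ?x "poly (cpoly g)" "\<lambda>x. poly (cpoly p) x * H x"] by blast
    from DERIV_unique[OF poly_DERIV this]
    have "poly (pderiv (cpoly g)) ?x = poly (cpoly p) ?x * of_real ?D" .
    then have "complex_of_real (poly (pderiv g) z) = of_real (poly p z * ?D)"
      by (simp only: pderiv_cpoly poly_cpoly_of_real of_real_mult)
    then have "poly (pderiv g) z = poly p z * ?D" by (simp only: of_real_eq_iff)
    moreover have "0 < ?D" by (rule pos[OF _ rt(1)]) (use ne in auto)
    moreover have "poly p z \<noteq> 0" using rt(2) by (simp add: poly_cpoly_of_real)
    ultimately have "0 < ?D * (poly p z * poly p z)"
      by (intro mult_pos_pos[of ?D]) (auto simp: zero_less_mult_iff)
    with \<open>poly (pderiv g) z = poly p z * ?D\<close> show ?thesis by (simp only: mult_ac)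
  qed
  have "rsquarefree (cpoly g)"
    unfolding rsquarefree_roots
  proof (intro allI notI, elim conjE)
    fix z assume z: "poly (cpoly g) z = 0" and z': "poly (pderiv (cpoly g)) z = 0"
    obtain x where x: "z = of_real x" using real[OF z] by (auto elim: Reals_cases)
    have "poly g x = 0" "poly (pderiv g) x = 0"
      using z z' unfolding x pderiv_cpoly poly_cpoly_of_real by simp_all
    with dpos[of x] show False by simp
  qed
  with real show "real_simple_zeros g" by (simp add: real_simple_zeros_iff_rsquarefree)
qed

lemma real_simple_zeros_uminus: "real_simple_zeros (- p) \<longleftrightarrow> real_simple_zeros p"
proof -
  have "cpoly (- p) = - cpoly p" by (intro poly_eqI) (simp add: coeff_map_poly)
  then show ?thesis
    unfolding real_simple_zeros_iff_rsquarefree rsquarefree_roots by (simp add: pderiv_minus)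
qed

text \<open>The transfer applied to \<open>- q\<close>: passing from one polynomial to the other
  reverses the sign.\<close>

corollary interlacing_swap:
  fixes p q :: "real poly"
  assumes "real_simple_zeros p" "q \<noteq> 0" "degree q \<le> degree p"
    and "\<And>y. poly p y = 0 \<Longrightarrow> 0 < poly (pderiv p) y * poly q y"
  shows "real_simple_zeros q"
    and "\<And>z. poly q z = 0 \<Longrightarrow> poly (pderiv q) z * poly p z < 0"
  using interlacing_transfer[of p "- q"] assms
  by (auto simp: real_simple_zeros_uminus pderiv_minus)

section \<open>From signs at the zeros to separation of zeros\<close>

lemma zero_between_consecutive_zeros:
  fixes p q :: "real poly" and s :: real
  assumes ab: "a < b" "poly p a = 0" "poly p b = 0" "\<And>x. a < x \<Longrightarrow> x < b \<Longrightarrow> poly p x \<noteq> 0"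
    and sgn: "\<And>y. poly p y = 0 \<Longrightarrow> 0 < s * (poly (pderiv p) y * poly q y)"
  shows "\<exists>x. a < x \<and> x < b \<and> poly q x = 0"
proof -
  \<comment> \<open>With \<open>p = (x - a)(x - b) h\<close>, the cofactor \<open>h\<close> keeps
    its sign on the closed interval, so \<open>p'\<close> has opposite signs at \<open>a\<close> and
    \<open>b\<close>. Hence so has \<open>q\<close>, whichever sign \<open>s\<close> has.\<close>
  obtain h0 where h0: "p = [:-a, 1:] * h0" using ab(2) by (auto simp: poly_eq_0_iff_dvd dvd_def)
  have "poly h0 b = 0" using ab(1,3) unfolding h0 by simp
  then obtain h where h: "h0 = [:-b, 1:] * h" by (auto simp: poly_eq_0_iff_dvd dvd_def)
  have p: "p = [:-a, 1:] * ([:-b, 1:] * h)" unfolding h0 h ..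
  have da: "poly (pderiv p) a = (a - b) * poly h a" and db: "poly (pderiv p) b = (b - a) * poly h b"
    unfolding p poly_pderiv_linear_mult by (simp_all add: algebra_simps)
  have "poly h x \<noteq> 0" if "a \<le> x" "x \<le> b" for x
  proof (cases "a < x \<and> x < b")
    case True
    with ab(4)[of x] show ?thesis unfolding p by auto
  next
    case False
    with that have "x = a \<or> x = b" by linarith
    with sgn[OF ab(2)] sgn[OF ab(3)] show ?thesis unfolding da db by auto
  qed
  then have hab: "0 < poly h a * poly h b"
    using ab(1) poly_IVT[of a b h]
    by (metis less_eq_real_def linorder_neqE_linordered_idom mult_eq_0_iff)
  have "0 < (s * (poly (pderiv p) a * poly q a)) * (s * (poly (pderiv p) b * poly q b))"
    using sgn ab(2,3) by simp
  also have "\<dots> = - ((s * (b - a))\<^sup>2 * (poly h a * poly h b) * (poly q a * poly q b))"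
    unfolding da db by (simp add: algebra_simps power2_eq_square)
  finally have "(s * (b - a))\<^sup>2 * (poly h a * poly h b) * (poly q a * poly q b) < 0" by simp
  moreover have "0 \<le> (s * (b - a))\<^sup>2 * (poly h a * poly h b)" using hab by simp
  ultimately have "poly q a * poly q b < 0" by (meson linorder_not_le mult_nonneg_nonneg)
  with poly_IVT[OF ab(1)] show ?thesis by blast
qed

text \<open>Existence comes from the signs at the zeros of \<open>p\<close>, uniqueness from the
  same argument with \<open>p\<close> and \<open>q\<close> exchanged.\<close>

lemma separatesI:
  fixes p q :: "real poly" and s t :: real
  assumes q0: "q \<noteq> 0"
    and pq: "\<And>y. poly p y = 0 \<Longrightarrow> 0 < s * (poly (pderiv p) y * poly q y)"
    and qp: "\<And>z. poly q z = 0 \<Longrightarrow> 0 < t * (poly (pderiv q) z * poly p z)"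
  shows "separates p q"
  unfolding separates_def
proof (intro allI impI, elim conjE)
  fix a b assume ab: "a < b" "poly p a = 0" "poly p b = 0" "\<forall>x. a < x \<and> x < b \<longrightarrow> poly p x \<noteq> 0"
  obtain c where c: "a < c" "c < b" "poly q c = 0"
    using zero_between_consecutive_zeros[of a b p s q] ab pq by blast
  \<comment> \<open>Let \<open>m\<close> be the next zero of \<open>q\<close> after
    \<open>u\<close>. Between \<open>u\<close> and \<open>m\<close> lies a zero of \<open>p\<close>,
    although \<open>a\<close> and \<open>b\<close> are consecutive zeros of
    \<open>p\<close>.\<close>
  have no_two: False if uv: "a < u" "u < v" "v < b" "poly q u = 0" "poly q v = 0" for u v
  proof -
    let ?S = "{x. poly q x = 0} \<inter> {u<..v}"
    have fin: "finite ?S" using q0 by (simp add: poly_roots_finite)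
    define m where "m = Min ?S"
    have m: "m \<in> ?S" unfolding m_def using fin uv by (intro Min_in) auto
    have "poly q x \<noteq> 0" if "u < x" "x < m" for x
    proof
      assume "poly q x = 0"
      with that m have "x \<in> ?S" by auto
      with fin have "m \<le> x" unfolding m_def by (rule Min_le)
      with that show False by simp
    qed
    then obtain x where "u < x" "x < m" "poly p x = 0"
      using zero_between_consecutive_zeros[of u m q t p] m uv qp by auto
    with ab(4) uv m show False by auto
  qed
  have "{x. a < x \<and> x < b \<and> poly q x = 0} = {c}"
  proof (intro equalityI subsetI)
    fix x assume "x \<in> {x. a < x \<and> x < b \<and> poly q x = 0}"
    with no_two[of x c] no_two[of c x] c have "\<not> x < c" "\<not> c < x" by auto
    then show "x \<in> {c}" by simp
  qed (use c in simp)
  then show "card {x. a < x \<and> x < b \<and> poly q x = 0} = 1" by simp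
qed

lemma interlaceI:
  fixes p q :: "real poly"
  assumes p: "real_simple_zeros p" and q0: "q \<noteq> 0" and deg: "degree q \<le> degree p"
    and pq: "\<And>y. poly p y = 0 \<Longrightarrow> 0 < poly (pderiv p) y * poly q y"
  shows "interlace p q"
proof -
  note q = interlacing_swap[OF p q0 deg pq]
  have p0: "p \<noteq> 0" using p by (rule real_simple_zeros_nonzero)
  have "separates p q" by (rule separatesI[of q p 1 "-1"]) (use q0 pq q(2) in auto)
  moreover have "separates q p" by (rule separatesI[of p q "-1" 1]) (use p0 pq q(2) in auto)
  ultimately show ?thesis
    unfolding interlace_def using p p0 q0 q(1) pq by (metis less_irrefl mult_zero_right)
qed

section \<open>Integration against a beta weight\<close>

locale beta_weight =
  fixes a b :: real
  assumes a_pos: "0 < a" and b_pos: "0 < b"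
begin

text \<open>In the application \<open>a = \<alpha> + 1\<close> and \<open>b = \<beta>\<close>, so
  this is the Jacobi weight divided by \<open>1 - t\<close>; it arises when the Jacobi weight is
  integrated by parts.\<close>

definition E :: "real poly \<Rightarrow> real" where
  "E q = integral {0..1} (\<lambda>t. t powr (a - 1) * (1 - t) powr (b - 1) * poly q t)"

lemma has_integral_E:
  "((\<lambda>t. t powr (a - 1) * (1 - t) powr (b - 1) * poly q t) has_integral
     (\<Sum>k\<le>degree q. coeff q k * Beta (a + real k) b)) {0..1}"
proof -
  have "((\<lambda>t. \<Sum>k\<le>degree q. coeff q k * (t powr (a + real k - 1) * (1 - t) powr (b - 1)))
          has_integral (\<Sum>k\<le>degree q. coeff q k * Beta (a + real k) b)) {0..1}"
    using a_pos b_pos by (intro has_integral_sum has_integral_mult_right has_integral_Beta_real) auto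
  also have "?this \<longleftrightarrow> ?thesis"
  proof (rule has_integral_cong)
    fix t :: real assume t: "t \<in> {0..1}"
    have "t powr (a + real k - 1) = t powr (a - 1) * t ^ k" for k
    \<comment> \<open>At \<open>t = 0\<close> both sides are 0, since \<open>0 powr x = 0\<close>
      for every exponent.\<close>
    proof (cases "t = 0")
      case False
      with t have "t powr (a - 1 + real k) = t powr (a - 1) * t ^ k"
        by (simp add: powr_add powr_realpow)
      then show ?thesis by (simp add: algebra_simps)
    qed simp
    then show "(\<Sum>k\<le>degree q. coeff q k * (t powr (a + real k - 1) * (1 - t) powr (b - 1))) =
        t powr (a - 1) * (1 - t) powr (b - 1) * poly q t"
      by (simp add: poly_altdef sum_distrib_left mult_ac)
  qed
  finally show ?thesis .
qed

lemma integrable_E: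
  "(\<lambda>t. t powr (a - 1) * (1 - t) powr (b - 1) * poly q t) integrable_on {0..1}"
  using has_integral_E by blast

lemma E_add: "E (p + q) = E p + E q"
  unfolding E_def using integral_add[OF integrable_E[of p] integrable_E[of q]]
  by (simp add: distrib_left)

lemma E_smult: "E (smult c p) = c * E p"
proof -
  have "E (smult c p) = integral {0..1} (\<lambda>t. c * (t powr (a - 1) * (1 - t) powr (b - 1) * poly p t))"
    unfolding E_def by (simp add: mult_ac)
  then show ?thesis unfolding E_def by simp
qed

lemma E_0 [simp]: "E 0 = 0"
  by (simp add: E_def)

lemma E_minus: "E (- p) = - E p"
  using E_smult[of "-1" p] by simp

lemma E_diff: "E (p - q) = E p - E q"
  using E_add[of p "- q"] by (simp add: E_minus)

lemma E_sum: "E (\<Sum>i\<in>I. f i) = (\<Sum>i\<in>I. E (f i))"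
  by (induction I rule: infinite_finite_induct) (simp_all add: E_add)

lemma E_monom: "E (monom c k) = c * Beta (a + real k) b"
proof (cases "c = 0")
  case False
  have "E (monom c k) = (\<Sum>i\<le>degree (monom c k). coeff (monom c k) i * Beta (a + real i) b)"
    unfolding E_def by (rule integral_unique[OF has_integral_E])
  also have "\<dots> = (\<Sum>i\<le>k. if i = k then c * Beta (a + real k) b else 0)"
    using False by (intro sum.cong) (auto simp: degree_monom_eq)
  finally show ?thesis by simp
qed simp

lemma moment_recurrence: "(a + b + real k) * Beta (a + real (Suc k)) b = (a + real k) * Beta (a + real k) b"
proof -
  have "a + real k \<notin> \<int>\<^sub>\<le>\<^sub>0" using a_pos by (auto dest: nonpos_Ints_nonpos)
  from Beta_plus1_left[OF this, of b] show ?thesis by (simp add: algebra_simps)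
qed

text \<open>This is the vanishing integral of the derivative of \<open>t^a (1 - t)^b q\<close>. On
  monomials it reduces to the Beta recurrence, so no boundary terms need to be discussed.\<close>

lemma E_integration_by_parts:
  "E ([:0, 1, -1:] * pderiv q) = - E ([:a, -(a+b):] * q)"
proof -
  have *: "E ([:0, 1, -1:] * pderiv (monom c k)) = - E ([:a, -(a+b):] * monom c k)" for c k
  proof -
    have 1: "[:a, -(a+b):] * monom c k = monom (a * c) k - monom ((a + b) * c) (Suc k)"
      by (simp add: smult_monom monom_Suc algebra_simps add_monom)
    have 2: "[:0, 1, -1:] * pderiv (monom c k) = monom (real k * c) k - monom (real k * c) (Suc k)"
      unfolding pderiv_monom by (cases k) (simp_all add: monom_Suc algebra_simps)
    have "c * ((a + b + real k) * Beta (a + real (Suc k)) b) = c * ((a + real k) * Beta (a + real k) b)"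
      by (simp only: moment_recurrence)
    then show ?thesis unfolding 1 2 E_diff E_monom by (simp only: algebra_simps)
  qed
  have "E ([:0, 1, -1:] * pderiv (\<Sum>i\<le>degree q. monom (coeff q i) i)) =
     - E ([:a, -(a+b):] * (\<Sum>i\<le>degree q. monom (coeff q i) i))"
    by (simp only: higher_pderiv_sum[of 1, simplified] sum_distrib_left E_sum * sum_negf)
  then show ?thesis by (simp only: poly_as_sum_of_monoms)
qed

text \<open>The weight may be singular at 0 and 1, so the integral is bounded below by the one over
  \<open>[1/4, 3/4]\<close>, where the weight is continuous and positive.\<close>

lemma E_pos:
  assumes nonneg: "\<And>t. 0 \<le> t \<Longrightarrow> t \<le> 1 \<Longrightarrow> 0 \<le> poly q t" and "q \<noteq> 0"
  shows "0 < E q"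
proof -
  define f where "f t = t powr (a - 1) * (1 - t) powr (b - 1) * poly q t" for t
  have f0: "0 \<le> f t" if "t \<in> {0..1}" for t
    using nonneg that by (auto simp: f_def)
  have cont: "continuous_on {1/4..3/4} f"
    unfolding f_def by (intro continuous_intros) auto
  then have int: "f integrable_on {1/4..3/4}" by (rule integrable_continuous_real)
  have "f integrable_on {0..1}" unfolding f_def by (rule integrable_E)
  with int have le: "integral {1/4..3/4} f \<le> E q"
    unfolding E_def f_def[symmetric] by (intro integral_subset_le) (use f0 in auto)
  have "0 \<le> integral {1/4..3/4} f"
    using int by (rule integral_nonneg) (use f0 in auto)
  moreover have "integral {1/4..3/4} f \<noteq> 0"
  proof
    assume "integral {1/4..3/4} f = 0"
    then have "\<forall>t\<in>{1/4..3/4}. f t = 0"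
      using integral_eq_0_iff[OF cont] f0 by auto
    then have "{1/4..3/4} \<subseteq> {t. poly q t = 0}" by (auto simp: f_def)
    moreover have "finite {t. poly q t = 0}" using \<open>q \<noteq> 0\<close> by (rule poly_roots_finite)
    ultimately have "finite {1/4..3/4::real}" by (rule finite_subset)
    then show False by (simp add: infinite_Icc)
  qed
  ultimately show ?thesis using le by linarith
qed

end

section \<open>Jacobi polynomials\<close>

text \<open>The Jacobi polynomial with parameters \<open>a - 1\<close> and \<open>b\<close>, at the
  point \<open>1 - 2 t\<close>.\<close>

definition jacobi :: "nat \<Rightarrow> real \<Rightarrow> real \<Rightarrow> real poly" where
  "jacobi n a b = (\<Sum>k\<le>n. monom (pochhammer a n / fact n * pochhammer (- real n) k
      * pochhammer (real n + a + b) k / (fact k * pochhammer a k)) k)"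

lemma coeff_jacobi:
  "coeff (jacobi n a b) k = pochhammer a n / fact n * pochhammer (- real n) k
      * pochhammer (real n + a + b) k / (fact k * pochhammer a k)"
proof -
  have "pochhammer (- real n) k = 0" if "k > n"
    using that by (simp add: pochhammer_of_nat_eq_0_iff)
  then show ?thesis
    unfolding jacobi_def coeff_sum by (cases "k \<le> n") (auto simp: if_distrib cong: if_cong)
qed

text \<open>The term ratio of the hypergeometric series, cleared of denominators.\<close>

lemma coeff_jacobi_Suc:
  assumes "0 < a"
  shows "(real k + 1) * (real k + a) * coeff (jacobi n a b) (Suc k)
    = (real k - real n) * (real k + real n + a + b) * coeff (jacobi n a b) k"
proof -
  define C P Q D where "C = pochhammer a n / fact n" and "P = pochhammer (- real n) k"
    and "Q = pochhammer (real n + a + b) k" and "D = fact k * pochhammer a k"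
  have c: "coeff (jacobi n a b) k = C * P * Q / D"
    unfolding coeff_jacobi C_def P_def Q_def D_def ..
  have "coeff (jacobi n a b) (Suc k) =
      C * (P * (- real n + real k)) * (Q * (real n + a + b + real k)) / ((real k + 1) * (real k + a) * D)"
    unfolding coeff_jacobi C_def P_def Q_def D_def pochhammer_Suc fact_Suc by (simp add: mult_ac add_ac)
  moreover have "(real k + 1) * (real k + a) \<noteq> 0" using assms by simp
  ultimately show ?thesis unfolding c by (simp add: mult_ac add_ac)
qed

lemma pderiv_jacobi:
  assumes "0 < a" "0 < n"
  shows "pderiv (jacobi n a b) = smult (- (real n + a + b)) (jacobi (n - 1) (a + 1) (b + 1))"
proof (rule poly_eqI)
  fix k
  obtain m where n: "n = Suc m" using assms(2) by (cases n) auto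
  have 1: "pochhammer (- real n) (Suc k) = - (1 + real m) * pochhammer (- real m) k"
    unfolding pochhammer_rec n by simp
  have 2: "pochhammer (real n + a + b) (Suc k) = (real n + a + b) * pochhammer (real m + (a + 1) + (b + 1)) k"
    unfolding pochhammer_rec n by (simp add: add_ac)
  have 3: "pochhammer a (Suc k) = a * pochhammer (a + 1) k" for k
    by (rule pochhammer_rec)
  have cancel: "x * (a * C / (v * F) * (- v * P) * (u * Q) / (x * G * (a * A))) = - u * (C / F * P * Q / (G * A))"
    if "x \<noteq> 0" "v \<noteq> 0" for x v u C F P Q G A :: real
    using that assms by simp
  have "coeff (pderiv (jacobi n a b)) k = real (Suc k) * (a * pochhammer (a + 1) m / ((1 + real m) * fact m)
      * (- (1 + real m) * pochhammer (- real m) k)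
      * ((real n + a + b) * pochhammer (real m + (a + 1) + (b + 1)) k)
      / (real (Suc k) * fact k * (a * pochhammer (a + 1) k)))"
    unfolding coeff_pderiv coeff_jacobi 1 2 3 fact_Suc by (simp add: n 3)
  also have "\<dots> = coeff (smult (- (real n + a + b)) (jacobi (n - 1) (a + 1) (b + 1))) k"
    unfolding coeff_smult coeff_jacobi by (subst cancel) (simp_all add: n)
  finally show "coeff (pderiv (jacobi n a b)) k =
      coeff (smult (- (real n + a + b)) (jacobi (n - 1) (a + 1) (b + 1))) k" .
qed

text \<open>The sign comes from \<open>(-n)_n = (-1)^n n!\<close>; its alternation fixes the sign of
  the constant \<open>K\<close> in the energy inequalities.\<close>

lemma lead_jacobi:
  assumes "0 < a" "0 < b"
  shows "0 < (-1) ^ n * coeff (jacobi n a b) n"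
proof -
  have "pochhammer a n \<noteq> 0" using assms pochhammer_pos[of a n] by simp
  then have "(-1) ^ n * coeff (jacobi n a b) n = pochhammer (real n + a + b) n / fact n"
    unfolding coeff_jacobi pochhammer_same by (simp flip: power_add)
  also have "0 < \<dots>" using assms by (intro divide_pos_pos pochhammer_pos) auto
  finally show ?thesis .
qed

lemma degree_jacobi:
  assumes "0 < a" "0 < b"
  shows "degree (jacobi n a b) = n"
proof (rule antisym)
  show "degree (jacobi n a b) \<le> n"
    by (rule degree_le) (auto simp: coeff_jacobi pochhammer_of_nat_eq_0_iff)
  show "n \<le> degree (jacobi n a b)"
    using lead_jacobi[OF assms, of n] by (intro le_degree) auto
qed

lemma jacobi_equation:
  assumes "0 < a"
  shows "[:0, 1, -1:] * pderiv (pderiv (jacobi n a b)) + [:a, -(a + b + 1):] * pderiv (jacobi n a b)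
    = smult (- (real n * (real n + a + b))) (jacobi n a b)" (is "?l = ?r")
proof (rule poly_eqI)
  fix k
  let ?c = "coeff (jacobi n a b)"
  have "coeff ?l k = (real k + 1) * (real k + a) * ?c (Suc k) - real k * (real k + a + b) * ?c k"
  proof (cases k)
    case 0
    then show ?thesis by (simp add: coeff_pderiv)
  next
    case (Suc j)
    then show ?thesis by (cases j) (simp_all add: coeff_pderiv algebra_simps)
  qed
  also have "\<dots> = coeff ?r k"
    unfolding coeff_jacobi_Suc[OF assms] by (simp add: algebra_simps)
  finally show "coeff ?l k = coeff ?r k" .
qed

lemma poly_identity: "(\<And>x. poly p x = poly q x) \<Longrightarrow> p = q" for p q :: "real poly"
  by (metis ext poly_eq_poly_eq_iff)

section \<open>Orthogonality of the Jacobi polynomials\<close>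

context beta_weight
begin

text \<open>Integration against \<open>t^(a-1) (1-t)^b\<close>, the weight for which the polynomials
  \<open>J n\<close> are orthogonal.\<close>

definition L :: "real poly \<Rightarrow> real" where "L q = E ([:1, -1:] * q)"

lemma L_add: "L (p + q) = L p + L q"
  by (simp only: L_def distrib_left E_add)

lemma L_smult: "L (smult c p) = c * L p"
  by (simp only: L_def mult_smult_right E_smult)

lemma L_diff: "L (p - q) = L p - L q"
  by (simp only: L_def right_diff_distrib E_diff)

abbreviation J :: "nat \<Rightarrow> real poly" where "J n \<equiv> jacobi n a b"

text \<open>Integration by parts applied to \<open>(1 - t) p q'\<close>; the right-hand side is
  symmetric in \<open>p\<close> and \<open>q\<close>, so the Jacobi operator is
  self-adjoint.\<close>

lemma L_sturm_liouville:
  "L (p * ([:0, 1, -1:] * pderiv (pderiv q) + [:a, -(a + b + 1):] * pderiv q))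
    = - L ([:0, 1, -1:] * (pderiv p * pderiv q))"
proof -
  have pd: "pderiv ([:1, -1:] * r) = [:1, -1:] * pderiv r - r" for r :: "real poly"
    by (simp only: pderiv_mult pderiv_pCons) simp
  have "[:1, -1:] * (p * ([:0, 1, -1:] * pderiv (pderiv q) + [:a, -(a + b + 1):] * pderiv q))
      + [:1, -1:] * ([:0, 1, -1:] * (pderiv p * pderiv q))
    = [:0, 1, -1:] * pderiv ([:1, -1:] * (p * pderiv q)) + [:a, -(a + b):] * ([:1, -1:] * (p * pderiv q))"
    unfolding pd unfolding pderiv_mult by (rule poly_identity) (simp add: algebra_simps)
  from arg_cong[OF this, of E] show ?thesis
    unfolding E_add E_integration_by_parts L_def by simp
qed

text \<open>Eigenfunctions of a self-adjoint operator; the eigenvalues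
  \<open>- n (n + a + b)\<close> are pairwise distinct.\<close>

lemma jacobi_orthogonal:
  assumes "m \<noteq> n" shows "L (J m * J n) = 0"
proof -
  have eq: "- (real n * (real n + a + b)) * L (J m * J n) = - L ([:0, 1, -1:] * (pderiv (J m) * pderiv (J n)))" for m n
  proof -
    have "- (real n * (real n + a + b)) * L (J m * J n) = L (J m * smult (- (real n * (real n + a + b))) (J n))"
      by (simp only: mult_smult_right L_smult)
    then show ?thesis
      unfolding jacobi_equation[OF a_pos, symmetric] L_sturm_liouville .
  qed
  have "real n * (real n + a + b) * L (J m * J n) = real m * (real m + a + b) * L (J m * J n)"
    using eq[of n m] eq[of m n] by (simp add: mult.commute)
  then have "(real n - real m) * (real n + real m + a + b) * L (J m * J n) = 0"
    by (simp add: algebra_simps)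
  moreover have "real n + real m + a + b \<noteq> 0" using a_pos b_pos by linarith
  ultimately show ?thesis using assms by simp
qed

lemma L_square_pos: "q \<noteq> 0 \<Longrightarrow> 0 < L (q * q)"
  unfolding L_def
proof (rule E_pos)
  fix t :: real assume "0 \<le> t" "t \<le> 1"
  then have "0 \<le> (1 - t) * (poly q t * poly q t)" by simp
  then show "0 \<le> poly ([:1, -1:] * (q * q)) t" by (simp add: left_diff_distrib)
qed (simp only: mult_eq_0_iff, simp)

text \<open>Subtracting multiples of Jacobi polynomials from \<open>q\<close> lowers its degree step
  by step; only the multiple of \<open>J n\<close> contributes. If \<open>degree q < n\<close>, the
  right-hand side is 0.\<close>

lemma L_jacobi_mult:
  assumes "degree q \<le> n"
  shows "L (J n * q) = coeff q n / coeff (J n) n * L (J n * J n)"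
  using assms
proof (induction "degree q" arbitrary: q rule: less_induct)
  case less
  let ?d = "degree q"
  have lead: "coeff (J m) m \<noteq> 0" for m using lead_jacobi[OF a_pos b_pos, of m] by auto
  let ?e = "coeff q ?d / coeff (J ?d) ?d"
  define r where "r = q - smult ?e (J ?d)"
  have q: "q = smult ?e (J ?d) + r" by (simp add: r_def)
  have r: "L (J n * r) = 0"
  proof (cases "r = 0")
    case True
    then show ?thesis by (simp add: L_def)
  next
    case False
    have "degree r \<le> ?d"
      unfolding r_def by (rule degree_diff_le) (auto simp: degree_jacobi a_pos b_pos)
    moreover have "coeff r ?d = 0" using lead by (simp add: r_def)
    ultimately have "degree r < ?d"
      using False by (metis leading_coeff_0_iff le_neq_implies_less)
    moreover from this less.prems have "coeff r n = 0" by (intro coeff_eq_0) simp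
    ultimately show ?thesis using less.hyps[of r] less.prems by simp
  qed
  have "L (J n * q) = ?e * L (J n * J ?d)"
    by (subst q) (simp only: distrib_left mult_smult_right L_add L_smult r)
  then show ?case
    using less.prems jacobi_orthogonal[of n ?d] by (cases "?d = n") (auto simp: coeff_eq_0)
qed

section \<open>Positivity of the energy integrals\<close>

lemma sum_squares_nonzero:
  fixes S R :: "real poly"
  assumes "S \<noteq> 0 \<or> R \<noteq> 0" shows "S * S + R * R \<noteq> 0"
proof
  assume 0: "S * S + R * R = 0"
  have "poly S x = 0 \<and> poly R x = 0" for x
    using arg_cong[OF 0, of "\<lambda>p. poly p x"] by (simp add: sum_squares_eq_zero_iff)
  then have "S = 0" "R = 0" by (auto intro: poly_identity)
  with assms show False by simp
qed

text \<open>
  Here \<open>y = U + i V\<close>; the first inequality comes from testing with the conjugate of \<open>y / t\<close>,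
  the second from testing with the conjugate of \<open>y'\<close>.
\<close>

lemma energy_inequalities:
  fixes U V :: "real poly"
  assumes w: "0 < w" and a1: "a \<le> 1"
    and U: "U - smult w (pderiv V) = smult p0 (J (Suc m)) - smult p1 (J m)"
    and V: "V + smult w (pderiv U) = smult q0 (J (Suc m)) - smult q1 (J m)"
    and bd: "poly U 0 = 0" "poly V 0 = 0"
    and deg: "degree U \<le> Suc m" "degree V \<le> Suc m"
    and nz: "p0 \<noteq> 0 \<or> q0 \<noteq> 0"
  shows "0 < q1 * p0 - p1 * q0" and "0 < p1 * p0 + q1 * q0"
proof -
  let ?l = "\<lambda>k. coeff (J k) k"
  have lead: "0 < (-1) ^ k * ?l k" for k by (rule lead_jacobi[OF a_pos b_pos])
  have l0: "?l k \<noteq> 0" for k using lead[of k] by auto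
  have Jm: "coeff (J m) (Suc m) = 0"
    by (rule coeff_eq_0) (simp add: degree_jacobi a_pos b_pos)
  have cU: "coeff U (Suc m) = p0 * ?l (Suc m)"
  proof -
    have "coeff (pderiv V) (Suc m) = 0" unfolding coeff_pderiv using deg by (simp add: coeff_eq_0)
    with arg_cong[OF U, of "\<lambda>p. coeff p (Suc m)"] Jm show ?thesis by simp
  qed
  have cV: "coeff V (Suc m) = q0 * ?l (Suc m)"
  proof -
    have "coeff (pderiv U) (Suc m) = 0" unfolding coeff_pderiv using deg by (simp add: coeff_eq_0)
    with arg_cong[OF V, of "\<lambda>p. coeff p (Suc m)"] Jm show ?thesis by simp
  qed
  \<comment> \<open>Since \<open>y\<close> vanishes at 0, \<open>y / t = S + i R\<close> is a
    polynomial; \<open>T\<close> below is its squared modulus.\<close>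
  obtain S where S: "U = pCons 0 S" using bd(1) by (cases U) auto
  obtain R where R: "V = pCons 0 R" using bd(2) by (cases V) auto
  have degS: "degree S \<le> m" and degR: "degree R \<le> m"
    using deg unfolding S R by (auto split: if_splits)
  define h where "h = L (J m * J m)"
  define K where "K = - (?l (Suc m) / ?l m * h)"
  have h: "0 < h" unfolding h_def using l0[of m] by (intro L_square_pos) auto
  have K: "0 < K"
  proof -
    have "0 < ((-1) ^ Suc m * ?l (Suc m)) * ((-1) ^ m * ?l m)" by (rule mult_pos_pos[OF lead lead])
    then have "?l (Suc m) * ?l m < 0" by (simp add: algebra_simps flip: power_add)
    then have "?l (Suc m) / ?l m < 0" by (auto simp: mult_less_0_iff divide_less_0_iff)
    from mult_neg_pos[OF this h] show ?thesis unfolding K_def by linarith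
  qed
  \<comment> \<open>A test polynomial of degree at most \<open>m\<close> annihilates
    \<open>J (Suc m)\<close> and sees \<open>J m\<close> only through its coefficient at
    \<open>m\<close>. The leading coefficients of \<open>J m\<close> and \<open>J (Suc m)\<close>
    have opposite signs, whence \<open>K > 0\<close>.\<close>
  have LJ: "L ((smult x (J (Suc m)) - smult y (J m)) * q) = y * z * K"
    if "degree q \<le> m" "coeff q m = z * ?l (Suc m)" for x y z q
  proof -
    have "L (J (Suc m) * q) = 0"
      using that(1) by (subst L_jacobi_mult) (auto simp: coeff_eq_0)
    moreover have "L (J m * q) = - z * K"
      using that by (subst L_jacobi_mult) (auto simp: K_def h_def)
    ultimately show ?thesis
      by (simp only: left_diff_distrib mult_smult_left L_diff L_smult)
  qed
  define T where "T = S * S + R * R"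
  have "?l (Suc m) * p0 \<noteq> 0 \<or> ?l (Suc m) * q0 \<noteq> 0" using nz l0 by simp
  then have "S \<noteq> 0 \<or> R \<noteq> 0" using cU cV unfolding S R by (auto simp: mult.commute)
  then have T0: "T \<noteq> 0" unfolding T_def by (rule sum_squares_nonzero)
  have Tpos: "0 \<le> poly T t" for t by (simp add: T_def)
  \<comment> \<open>Imaginary part of \<open>y + i w y'\<close> times the conjugate of
    \<open>y / t\<close>; the contribution of \<open>y\<close> itself is \<open>t T\<close>, which
    is real and drops out.\<close>
  show "0 < q1 * p0 - p1 * q0"
  proof -
    have "L ((smult q0 (J (Suc m)) - smult q1 (J m)) * S) = q1 * p0 * K"
      by (rule LJ) (use degS cU in \<open>auto simp: S\<close>)
    moreover have "L ((smult p0 (J (Suc m)) - smult p1 (J m)) * R) = p1 * q0 * K"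
      by (rule LJ) (use degR cV in \<open>auto simp: R\<close>)
    ultimately have "(q1 * p0 - p1 * q0) * K = L ((V + smult w (pderiv U)) * S - (U - smult w (pderiv V)) * R)"
      unfolding U V L_diff by (simp add: algebra_simps)
    also have "(V + smult w (pderiv U)) * S - (U - smult w (pderiv V)) * R =
        smult w (T + smult (1/2) ([:0, 1:] * pderiv T))"
      unfolding S R T_def
      by (rule poly_identity) (simp add: pderiv_mult pderiv_add pderiv_pCons algebra_simps)
    also have "L \<dots> = w * (E ([:1, -1:] * T) + 1/2 * E ([:0, 1, -1:] * pderiv T))"
    proof -
      have "[:1, -1:] * ([:0, 1:] * pderiv T) = [:0, 1, -1:] * pderiv T"
        by (rule poly_identity) (simp add: algebra_simps)
      then show ?thesis
        by (simp only: L_smult L_add) (simp only: L_def)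
    qed
    also have "\<dots> = w * E ([:1, -1:] * T - smult (1/2) ([:a, -(a+b):] * T))"
      unfolding E_integration_by_parts E_diff E_smult by simp
    also have "[:1, -1:] * T - smult (1/2) ([:a, -(a+b):] * T) = [:1 - a/2, -1 + (a+b)/2:] * T"
      by (rule poly_identity) (simp add: algebra_simps)
    also have "0 < w * E \<dots>"
    proof (intro mult_pos_pos w E_pos)
      fix t :: real assume t: "0 \<le> t" "t \<le> 1"
      \<comment> \<open>Interpolating linearly between the values \<open>1 - a/2\<close> at 0 and
        \<open>b/2\<close> at 1 makes the sign on the unit interval visible.\<close>
      have "poly [:1 - a/2, -1 + (a+b)/2:] t = (1 - a/2) * (1 - t) + b/2 * t"
        by (simp add: field_simps)
      moreover have "0 \<le> (1 - a/2) * (1 - t) + b/2 * t"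
        using t a1 b_pos by simp
      ultimately show "0 \<le> poly ([:1 - a/2, -1 + (a+b)/2:] * T) t"
        using Tpos by (simp only: poly_mult mult_nonneg_nonneg)
    qed (unfold mult_eq_0_iff, use T0 a1 in simp)
    finally show ?thesis using K by (simp add: zero_less_mult_iff)
  qed
  \<comment> \<open>Real part of \<open>y + i w y'\<close> times the conjugate of \<open>y'\<close>;
    the term \<open>i w |y'|^2\<close> drops out and half the derivative of
    \<open>|y|^2 = t^2 T\<close> remains. The factor \<open>Suc m\<close> comes from the leading
    coefficient of \<open>y'\<close>.\<close>
  show "0 < p1 * p0 + q1 * q0"
  proof -
    have dU: "degree (pderiv U) \<le> m" "degree (pderiv V) \<le> m"
      using deg by (auto simp: degree_pderiv)
    have "L ((smult p0 (J (Suc m)) - smult p1 (J m)) * pderiv U) = p1 * (real (Suc m) * p0) * K"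
      by (rule LJ[OF dU(1)]) (simp add: coeff_pderiv cU)
    moreover have "L ((smult q0 (J (Suc m)) - smult q1 (J m)) * pderiv V) = q1 * (real (Suc m) * q0) * K"
      by (rule LJ[OF dU(2)]) (simp add: coeff_pderiv cV)
    ultimately have "(p1 * p0 + q1 * q0) * (real (Suc m) * K) =
        L ((U - smult w (pderiv V)) * pderiv U + (V + smult w (pderiv U)) * pderiv V)"
      unfolding U V L_add by (simp add: algebra_simps)
    also have "(U - smult w (pderiv V)) * pderiv U + (V + smult w (pderiv U)) * pderiv V =
        smult (1/2) ([:0, 1:] * (T + pderiv ([:0, 1:] * T)))"
      unfolding S R T_def
      by (rule poly_identity) (simp add: pderiv_mult pderiv_add pderiv_pCons algebra_simps)
    also have "L \<dots> = 1/2 * (E ([:0, 1, -1:] * T) + E ([:0, 1, -1:] * pderiv ([:0, 1:] * T)))"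
    proof -
      have "[:1, -1:] * ([:0, 1:] * p) = [:0, 1, -1:] * p" for p :: "real poly"
        by (rule poly_identity) (simp add: algebra_simps)
      then show ?thesis
        by (simp only: L_smult) (simp only: L_def distrib_left E_add)
    qed
    also have "\<dots> = 1/2 * E ([:0, 1, -1:] * T - [:a, -(a+b):] * ([:0, 1:] * T))"
      unfolding E_integration_by_parts E_diff by simp
    also have "[:0, 1, -1:] * T - [:a, -(a+b):] * ([:0, 1:] * T) = [:0, 1 - a, a + b - 1:] * T"
      by (rule poly_identity) (simp add: algebra_simps)
    also have "0 < 1/2 * E \<dots>"
    proof (intro mult_pos_pos E_pos)
      fix t :: real assume t: "0 \<le> t" "t \<le> 1"
      \<comment> \<open>Here \<open>1 - a = - \<alpha>\<close> appears as a coefficient, so its sign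
        is the assumption \<open>a \<le> 1\<close>.\<close>
      have "poly [:0, 1 - a, a + b - 1:] t = t * ((1 - a) * (1 - t) + b * t)"
        by (simp add: algebra_simps)
      moreover have "0 \<le> t * ((1 - a) * (1 - t) + b * t)"
        using t a1 b_pos by simp
      ultimately show "0 \<le> poly ([:0, 1 - a, a + b - 1:] * T) t"
        using Tpos by (simp only: poly_mult mult_nonneg_nonneg)
    next
      have "a + b - 1 \<noteq> 0 \<or> 1 - a \<noteq> 0" using b_pos by linarith
      then show "[:0, 1 - a, a + b - 1:] * T \<noteq> 0" unfolding mult_eq_0_iff using T0 by auto
    qed simp
    finally have "0 < (p1 * p0 + q1 * q0) * (real (Suc m) * K)" .
    moreover have "0 < real (Suc m) * K" using K by simp
    ultimately show ?thesis by (rule zero_less_mult_pos2)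
  qed
qed

end

section \<open>Interlacing of the zeros of phi\<close>

text \<open>The Neumann series for the inverse of \<open>1 + c D^2\<close>, with \<open>D\<close>
  the derivative. A cutoff \<open>N\<close> independent of \<open>q\<close> makes it a linear
  operator commuting with \<open>pderiv\<close>.\<close>

definition resolvent :: "nat \<Rightarrow> real \<Rightarrow> real poly \<Rightarrow> real poly" where
  "resolvent N c q = (\<Sum>j\<le>N. smult ((- c) ^ j) ((pderiv ^^ (2 * j)) q))"

lemma smult_sum_right: "smult c (\<Sum>i\<in>I. f i) = (\<Sum>i\<in>I. smult c (f i))"
  by (induction I rule: infinite_finite_induct) (simp_all add: smult_add_right)

text \<open>
  If \<open>A + w\<^sup>2 A'' = q\<close>, then \<open>y = A - i w A'\<close> solves \<open>y + i w y' = q\<close>, so that only real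
  polynomials are needed.
\<close>

lemma resolvent_equation:
  assumes "degree q \<le> N"
  shows "resolvent N c q + smult c (pderiv (pderiv (resolvent N c q))) = q"
proof -
  have "pderiv (pderiv (resolvent N c q)) = (\<Sum>j\<le>N. smult ((- c) ^ j) ((pderiv ^^ (2 * Suc j)) q))"
    unfolding resolvent_def by (simp add: higher_pderiv_sum[of 1, simplified] pderiv_smult)
  then have "smult c (pderiv (pderiv (resolvent N c q))) =
      - (\<Sum>j\<le>N. smult ((- c) ^ Suc j) ((pderiv ^^ (2 * Suc j)) q))"
    by (simp add: smult_sum_right sum_negf)
  then have "resolvent N c q + smult c (pderiv (pderiv (resolvent N c q))) =
      (\<Sum>j\<le>N. smult ((- c) ^ j) ((pderiv ^^ (2 * j)) q) - smult ((- c) ^ Suc j) ((pderiv ^^ (2 * Suc j)) q))"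
    unfolding resolvent_def sum_subtractf by simp
  \<comment> \<open>The sum telescopes, and its last term contains a derivative of order above the
    degree of \<open>q\<close>.\<close>
  also have "\<dots> = q - smult ((- c) ^ Suc N) ((pderiv ^^ (2 * Suc N)) q)"
    by (subst sum_telescope) simp
  also have "(pderiv ^^ (2 * Suc N)) q = 0"
    by (intro poly_eqI) (use assms in \<open>simp add: coeff_higher_pderiv coeff_eq_0 del: funpow.simps\<close>)
  finally show ?thesis by simp
qed

lemma degree_resolvent: "degree (resolvent N c q) \<le> degree q"
  unfolding resolvent_def
  by (intro degree_sum_le) (auto intro: order_trans[OF degree_smult_le] simp: degree_higher_pderiv)

lemma pderiv_resolvent: "pderiv (resolvent N c q) = resolvent N c (pderiv q)"
  unfolding resolvent_def
  by (simp add: higher_pderiv_sum[of 1, simplified] pderiv_smult funpow_swap1)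

lemma resolvent_smult: "resolvent N c (smult d q) = smult d (resolvent N c q)"
  unfolding resolvent_def by (simp add: higher_pderiv_smult smult_sum_right mult.commute)

lemma poly_resolvent_0:
  "poly (resolvent N c q) 0 = (\<Sum>j\<le>N. (- c) ^ j * fact (2 * j) * coeff q (2 * j))"
  unfolding resolvent_def poly_sum
  by (simp add: poly_0_coeff_0 coeff_higher_pderiv mult.assoc flip: pochhammer_fact)

text \<open>From \<open>t = (1 - x) / 2\<close>, two derivatives in \<open>t\<close> are four times
  two derivatives in \<open>x\<close>, and \<open>t = 0\<close> is \<open>x = 1\<close>; this turns
  \<open>- c\<close> into the argument \<open>- 4 * c\<close>.\<close>

lemma resolvent_jacobi_at_0:
  assumes "0 < a" "n \<le> N"
  shows "poly (resolvent N c (jacobi n a b)) 0 = poly (phi n (a - 1) b) (- 4 * c)"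
proof -
  have "poly (phi n (a - 1) b) (- 4 * c) = (\<Sum>j\<le>n div 2. (- c) ^ j * fact (2 * j) * coeff (jacobi n a b) (2 * j))"
    unfolding phi_def coeff_jacobi poly_smult poly_sum poly_monom sum_distrib_left
  proof (intro sum.cong refl)
    fix k
    have p: "(1 / 4) ^ k * (- 4 * c) ^ k = (- c) ^ k" by (simp flip: power_mult_distrib)
    show "pochhammer (a - 1 + 1) n / fact n * (pochhammer (- real n) (2 * k) *
          pochhammer (real n + (a - 1) + b + 1) (2 * k) / pochhammer (a - 1 + 1) (2 * k) * (1 / 4) ^ k * (- 4 * c) ^ k)
        = (- c) ^ k * fact (2 * k) * (pochhammer a n / fact n * pochhammer (- real n) (2 * k) *
          pochhammer (real n + a + b) (2 * k) / (fact (2 * k) * pochhammer a (2 * k)))"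
      unfolding mult.assoc p by (simp add: add.assoc)
  qed
  also have "\<dots> = (\<Sum>j\<le>N. (- c) ^ j * fact (2 * j) * coeff (jacobi n a b) (2 * j))"
  proof (rule sum.mono_neutral_left)
    show "\<forall>j\<in>{..N} - {..n div 2}. (- c) ^ j * fact (2 * j) * coeff (jacobi n a b) (2 * j) = 0"
      unfolding coeff_jacobi by (auto simp: pochhammer_of_nat_eq_0_iff)
  qed (use assms in auto)
  finally show ?thesis unfolding poly_resolvent_0 by simp
qed

lemma coeff_phi:
  "coeff (phi n A B) k = (if k \<le> n div 2 then pochhammer (A + 1) n / fact n *
    (pochhammer (- real n) (2*k) * pochhammer (real n + A + B + 1) (2*k) / pochhammer (A + 1) (2*k) * (1/4) ^ k) else 0)"
  unfolding phi_def coeff_smult coeff_sum coeff_monom by (simp add: if_distrib cong: if_cong)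

section \<open>Signs of the coefficients and zeros of \<open>phi\<close>\<close>

context
  fixes A B :: real
  assumes A: "-1 < A" and B: "0 < B"
begin

text \<open>Only Pochhammer symbols of even order \<open>2 * k\<close> occur, so the signs in
  \<open>(-n)_(2k)\<close> cancel. Hence real zeros are negative and of the form
  \<open>- 4 w^2\<close>.\<close>

lemma coeff_phi_pos:
  assumes "k \<le> n div 2" shows "0 < coeff (phi n A B) k"
proof -
  have "0 < pochhammer (- real n) (2 * k)"
    unfolding pochhammer_minus using assms by (simp add: pochhammer_pos)
  moreover have "0 < pochhammer (real n + A + B + 1) (2 * k)"
    using A B by (intro pochhammer_pos) linarith
  moreover have "0 < pochhammer (A + 1) j" for j
    using A by (intro pochhammer_pos) linarith
  ultimately show ?thesis using assms by (simp add: coeff_phi)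
qed

lemma phi_nonzero: "phi n A B \<noteq> 0"
  using coeff_phi_pos[of 0 n] by auto

lemma degree_phi: "degree (phi n A B) = n div 2"
  using coeff_phi_pos[of "n div 2" n]
  by (intro antisym degree_le le_degree) (auto simp: coeff_phi)

lemma poly_phi_pos:
  assumes "0 \<le> x" shows "0 < poly (phi n A B) x"
proof -
  have c: "0 \<le> coeff (phi n A B) k" for k
    using coeff_phi_pos[of k n] by (cases "k \<le> n div 2") (auto simp: coeff_phi)
  have "0 < coeff (phi n A B) 0 * x ^ 0" using coeff_phi_pos[of 0 n] by simp
  also have "\<dots> \<le> (\<Sum>k\<le>degree (phi n A B). coeff (phi n A B) k * x ^ k)"
    by (rule member_le_sum) (use c assms in auto)
  finally show ?thesis by (simp add: poly_altdef)
qed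

lemma phi_zero_neg: "poly (phi n A B) x = 0 \<Longrightarrow> x < 0"
  using poly_phi_pos[of x n] by (cases "0 \<le> x") auto

end

section \<open>Rotation of the complex numbers \<open>f n\<close>\<close>

context beta_weight
begin

text \<open>\<open>F \<mu> n\<close> and \<open>w * G \<mu> n\<close> are the real and imaginary parts of \<open>f n\<close>, where \<open>\<mu> = - 4 w\<^sup>2\<close>.\<close>

definition F :: "real \<Rightarrow> nat \<Rightarrow> real" where
  "F \<mu> n = poly (phi n (a - 1) b) \<mu>"

definition G :: "real \<Rightarrow> nat \<Rightarrow> real" where
  "G \<mu> n = (if n = 0 then 0 else (real n + a + b) * poly (phi (n - 1) a (b + 1)) \<mu>)"

text \<open>Differentiation lowers the degree and raises both parameters by one. For
  \<open>n = 0\<close> the derivative is 0, which is the special value in \<open>G\<close>.\<close>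

lemma pderiv_resolvent_jacobi_at_0:
  assumes "n \<le> N"
  shows "poly (pderiv (resolvent N c (J n))) 0 = - G (- 4 * c) n"
proof (cases "n = 0")
  case True
  have "J 0 = [:1:]" by (simp add: jacobi_def)
  then show ?thesis using True by (simp add: G_def pderiv_resolvent poly_resolvent_0)
next
  case False
  then have "pderiv (J n) = smult (- (real n + a + b)) (jacobi (n - 1) (a + 1) (b + 1))"
    using a_pos by (intro pderiv_jacobi) auto
  moreover have "poly (resolvent N c (jacobi (n - 1) (a + 1) (b + 1))) 0 = poly (phi (n - 1) a (b + 1)) (- 4 * c)"
    using resolvent_jacobi_at_0[of "a + 1" "n - 1" N c "b + 1"] a_pos assms by simp
  ultimately show ?thesis using False by (simp add: pderiv_resolvent resolvent_smult G_def algebra_simps)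
qed

text \<open>The two quantities are the imaginary part, divided by \<open>w\<close>, and the real
  part of \<open>f (Suc m)\<close> times the conjugate of \<open>f m\<close>.\<close>

lemma phase_step:
  assumes w: "0 < w" and a1: "a \<le> 1" and \<mu>: "\<mu> = - 4 * (w * w)" and nz: "F \<mu> m \<noteq> 0 \<or> G \<mu> m \<noteq> 0"
  shows "0 < G \<mu> (Suc m) * F \<mu> m - F \<mu> (Suc m) * G \<mu> m"
    and "0 < F \<mu> (Suc m) * F \<mu> m + (w * w) * (G \<mu> (Suc m) * G \<mu> m)"
proof -
  define X where "X = resolvent (Suc m) (w * w) (J (Suc m))"
  define Y where "Y = resolvent (Suc m) (w * w) (J m)"
  note deg = degree_jacobi[OF a_pos b_pos]
  have X: "X + smult (w * w) (pderiv (pderiv X)) = J (Suc m)"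
    unfolding X_def by (rule resolvent_equation) (simp add: deg)
  have Y: "Y + smult (w * w) (pderiv (pderiv Y)) = J m"
    unfolding Y_def by (rule resolvent_equation) (simp add: deg)
  have X0: "poly X 0 = F \<mu> (Suc m)" "poly (pderiv X) 0 = - G \<mu> (Suc m)"
    unfolding X_def \<mu> F_def by (simp_all only: resolvent_jacobi_at_0[OF a_pos] pderiv_resolvent_jacobi_at_0 order_refl)
  have Y0: "poly Y 0 = F \<mu> m" "poly (pderiv Y) 0 = - G \<mu> m"
    unfolding Y_def \<mu> F_def by (simp_all add: resolvent_jacobi_at_0[OF a_pos] pderiv_resolvent_jacobi_at_0)
  have dX: "degree X \<le> Suc m" "degree Y \<le> Suc m"
    using degree_resolvent[of "Suc m" "w * w"] deg unfolding X_def Y_def by (metis, metis le_SucI)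
  define p0 p1 q0 q1 where "p0 = F \<mu> m" and "p1 = F \<mu> (Suc m)"
    and "q0 = w * G \<mu> m" and "q1 = w * G \<mu> (Suc m)"
  \<comment> \<open>\<open>U\<close> and \<open>V\<close> are the real and imaginary parts of
    \<open>f m (X - i w X') - f (Suc m) (Y - i w Y')\<close>.\<close>
  define U where "U = smult p0 X + smult (w * q0) (pderiv X) - smult p1 Y - smult (w * q1) (pderiv Y)"
  define V where "V = smult q0 X - smult (w * p0) (pderiv X) - smult q1 Y + smult (w * p1) (pderiv Y)"
  have dUV: "degree U \<le> Suc m" "degree V \<le> Suc m"
    unfolding U_def V_def using dX
    by (auto intro!: degree_diff_le degree_add_le order_trans[OF degree_smult_le] simp: degree_pderiv)
  have U: "U - smult w (pderiv V) = smult p0 (J (Suc m)) - smult p1 (J m)"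
    unfolding U_def V_def X[symmetric] Y[symmetric]
    by (rule poly_identity) (simp add: pderiv_add pderiv_diff pderiv_smult algebra_simps)
  have V: "V + smult w (pderiv U) = smult q0 (J (Suc m)) - smult q1 (J m)"
    unfolding U_def V_def X[symmetric] Y[symmetric]
    by (rule poly_identity) (simp add: pderiv_add pderiv_diff pderiv_smult algebra_simps)
  have bd: "poly U 0 = 0" "poly V 0 = 0"
    unfolding U_def V_def by (simp_all add: X0 Y0 p0_def p1_def q0_def q1_def)
  have "p0 \<noteq> 0 \<or> q0 \<noteq> 0" using nz w by (simp add: p0_def q0_def)
  from energy_inequalities[OF w a1 U V bd dUV this]
  have *: "0 < q1 * p0 - p1 * q0" "0 < p1 * p0 + q1 * q0" .
  have "q1 * p0 - p1 * q0 = w * (G \<mu> (Suc m) * F \<mu> m - F \<mu> (Suc m) * G \<mu> m)"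
    by (simp add: p0_def p1_def q0_def q1_def algebra_simps)
  with *(1) w show "0 < G \<mu> (Suc m) * F \<mu> m - F \<mu> (Suc m) * G \<mu> m"
    by (simp add: zero_less_mult_iff)
  from *(2) show "0 < F \<mu> (Suc m) * F \<mu> m + (w * w) * (G \<mu> (Suc m) * G \<mu> m)"
    by (simp add: p0_def p1_def q0_def q1_def algebra_simps)
qed

lemma phase_increments:
  assumes a1: "a \<le> 1" and \<mu>: "\<mu> < 0"
  shows "0 < G \<mu> (Suc m) * F \<mu> m - F \<mu> (Suc m) * G \<mu> m"
    and "0 < G \<mu> (Suc (Suc m)) * F \<mu> m - F \<mu> (Suc (Suc m)) * G \<mu> m"
proof -
  define w where "w = sqrt (- \<mu> / 4)"
  have w: "0 < w" "\<mu> = - 4 * (w * w)" using \<mu> by (auto simp: w_def)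
  \<comment> \<open>A positive determinant forces \<open>f (Suc m)\<close> to be nonzero, so
    nonvanishing propagates from \<open>f 0 = 1\<close>.\<close>
  have nz: "F \<mu> m \<noteq> 0 \<or> G \<mu> m \<noteq> 0" for m
  proof (induction m)
    case 0
    show ?case by (simp add: F_def phi_def)
  next
    case (Suc m)
    from phase_step(1)[OF w(1) a1 w(2) Suc] show ?case by auto
  qed
  note step = phase_step[OF w(1) a1 w(2) nz]
  show "0 < G \<mu> (Suc m) * F \<mu> m - F \<mu> (Suc m) * G \<mu> m" by (rule step(1))
  let ?I = "\<lambda>m. G \<mu> (Suc m) * F \<mu> m - F \<mu> (Suc m) * G \<mu> m"
  let ?R = "\<lambda>m. F \<mu> (Suc m) * F \<mu> m + (w * w) * (G \<mu> (Suc m) * G \<mu> m)"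
  let ?N = "(F \<mu> (Suc m))\<^sup>2 + (w * w) * (G \<mu> (Suc m))\<^sup>2"
  have "0 < ?I (Suc m) * ?R m + ?R (Suc m) * ?I m"
    by (intro add_pos_pos mult_pos_pos step)
  \<comment> \<open>Expand the imaginary part of the product of \<open>f (m + 2) * cnj (f (m + 1))\<close> and
    \<open>f (m + 1) * cnj (f m)\<close>.\<close>
  also have "\<dots> = ?N * (G \<mu> (Suc (Suc m)) * F \<mu> m - F \<mu> (Suc (Suc m)) * G \<mu> m)"
    by (simp add: algebra_simps power2_eq_square)
  finally show "0 < G \<mu> (Suc (Suc m)) * F \<mu> m - F \<mu> (Suc (Suc m)) * G \<mu> m"
    by (rule zero_less_mult_pos) (use nz[of "Suc m"] w(1) in \<open>auto simp: add_nonneg_pos add_pos_nonneg\<close>)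
qed

end

section \<open>Induction on the degree and the two interlacings\<close>

lemma product_sign_trans:
  fixes x y z :: real
  shows "0 < x * y \<Longrightarrow> 0 < y * z \<Longrightarrow> 0 < x * z"
    and "0 < x * y \<Longrightarrow> y * z < 0 \<Longrightarrow> x * z < 0"
    and "x * y < 0 \<Longrightarrow> y * z < 0 \<Longrightarrow> 0 < x * z"
  by (auto simp: zero_less_mult_iff mult_less_0_iff)

lemma phi_interlacing:
  fixes \<alpha> \<beta> :: real
  assumes \<alpha>: "-1 < \<alpha>" "\<alpha> \<le> 0" and \<beta>: "0 < \<beta>"
  shows "interlace (phi (Suc (Suc m)) (\<alpha>+1) (\<beta>+1)) (phi m (\<alpha>+1) (\<beta>+1))"
    and "interlace (phi (Suc (Suc m)) \<alpha> \<beta>) (phi m \<alpha> \<beta>)"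
proof -
  interpret beta_weight "\<alpha> + 1" \<beta> using \<alpha> \<beta> by unfold_locales auto
  let ?p = "\<lambda>n. phi n \<alpha> \<beta>"
  let ?q = "\<lambda>n. phi n (\<alpha>+1) (\<beta>+1)"
  have \<alpha>': "-1 < \<alpha> + 1" and \<beta>': "0 < \<beta> + 1" using \<alpha> \<beta> by auto
  note p = phi_nonzero[OF \<alpha>(1) \<beta>] degree_phi[OF \<alpha>(1) \<beta>] phi_zero_neg[OF \<alpha>(1) \<beta>]
    and q = phi_nonzero[OF \<alpha>' \<beta>'] degree_phi[OF \<alpha>' \<beta>'] phi_zero_neg[OF \<alpha>' \<beta>']
  define \<kappa> where "\<kappa> n = real (Suc n) + (\<alpha> + 1) + \<beta>" for n
  have \<kappa>: "0 < \<kappa> n" for n using \<alpha> \<beta> by (simp add: \<kappa>_def)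
  have F: "F \<mu> n = poly (?p n) \<mu>" and G: "G \<mu> (Suc n) = \<kappa> n * poly (?q n) \<mu>" for \<mu> n
    by (simp_all add: F_def G_def \<kappa>_def)
  have a1: "\<alpha> + 1 \<le> 1" using \<alpha> by simp
  note phase = phase_increments[OF a1, unfolded F]
  \<comment> \<open>Consecutive \<open>?p\<close> carry reality and simplicity upwards; the sign
    against \<open>?q n\<close> is carried along because the phase inequality at a zero of
    \<open>?p (Suc n)\<close> involves \<open>?q n\<close>. The start \<open>?p 1\<close> is a
    nonzero constant.\<close>
  have pq: "real_simple_zeros (?p (Suc n)) \<and>
      (\<forall>y. poly (?p (Suc n)) y = 0 \<longrightarrow> 0 < poly (pderiv (?p (Suc n))) y * poly (?q n) y)" for n
  proof (induction n)
    case 0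
    have "degree (?p (Suc 0)) = 0" unfolding p(2) by simp
    then obtain c where c: "?p (Suc 0) = [:c:]" by (rule degree_eq_zeroE)
    with p(1)[of "Suc 0"] have "c \<noteq> 0" by auto
    with c show ?case by (simp add: real_simple_zeros_def map_poly_pCons)
  next
    case (Suc n)
    have deg: "degree (?p (Suc (Suc n))) \<le> degree (?p (Suc n)) \<or>
        degree (?p (Suc (Suc n))) = Suc (degree (?p (Suc n))) \<and>
        0 < lead_coeff (?p (Suc n)) * lead_coeff (?p (Suc (Suc n)))"
    proof -
      have lead: "0 < lead_coeff (?p k)" for k
        unfolding p(2) by (rule coeff_phi_pos[OF \<alpha>(1) \<beta>]) simp
      have "degree (?p (Suc (Suc n))) \<le> degree (?p (Suc n)) \<or>
          degree (?p (Suc (Suc n))) = Suc (degree (?p (Suc n)))"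
        unfolding p(2) by linarith
      then show ?thesis using mult_pos_pos[OF lead lead] by blast
    qed
    \<comment> \<open>At a zero of \<open>F\<close> the determinant keeps only its second product,
      which compares \<open>?p (Suc (Suc n))\<close> with \<open>?q n\<close>; the induction
      hypothesis replaces \<open>?q n\<close> by the derivative.\<close>
    have sgn: "poly (pderiv (?p (Suc n))) y * poly (?p (Suc (Suc n))) y < 0" if y: "poly (?p (Suc n)) y = 0" for y
    proof -
      have "0 < \<kappa> n * - (poly (?q n) y * poly (?p (Suc (Suc n))) y)"
        using phase(1)[OF p(3)[OF y], of "Suc n"] y by (simp add: G mult_ac)
      from zero_less_mult_pos[OF this \<kappa>] have "poly (?q n) y * poly (?p (Suc (Suc n))) y < 0"
        by (simp only: neg_0_less_iff_less)
      moreover have "0 < poly (pderiv (?p (Suc n))) y * poly (?q n) y" using Suc y by blast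
      ultimately show ?thesis by (rule product_sign_trans(2)[rotated])
    qed
    have t: "real_simple_zeros (?p (Suc (Suc n)))"
      "\<And>z. poly (?p (Suc (Suc n))) z = 0 \<Longrightarrow> 0 < poly (pderiv (?p (Suc (Suc n)))) z * poly (?p (Suc n)) z"
      by (rule interlacing_transfer[OF conjunct1[OF Suc] p(1) _ deg], erule sgn)+
    have "0 < poly (pderiv (?p (Suc (Suc n)))) y * poly (?q (Suc n)) y" if y: "poly (?p (Suc (Suc n))) y = 0" for y
    proof -
      have "0 < \<kappa> (Suc n) * (poly (?p (Suc n)) y * poly (?q (Suc n)) y)"
        using phase(1)[OF p(3)[OF y], of "Suc n"] y by (simp add: G mult_ac)
      from product_sign_trans(1)[OF t(2)[OF y] zero_less_mult_pos[OF this \<kappa>]] show ?thesis .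
    qed
    with t(1) show ?case by blast
  qed
  show "interlace (?p (Suc (Suc m))) (?p m)"
  proof (rule interlaceI)
    fix y assume y: "poly (?p (Suc (Suc m))) y = 0"
    \<comment> \<open>The two-step inequality at a zero of \<open>?p (Suc (Suc m))\<close> compares
      \<open>?q (Suc m)\<close> with \<open>?p m\<close>.\<close>
    have "0 < \<kappa> (Suc m) * (poly (?q (Suc m)) y * poly (?p m) y)"
      using phase(2)[OF p(3)[OF y], of m] y by (simp add: G mult_ac)
    note qp = zero_less_mult_pos[OF this \<kappa>]
    have "0 < poly (pderiv (?p (Suc (Suc m)))) y * poly (?q (Suc m)) y"
      using pq[of "Suc m"] y by blast
    from product_sign_trans(1)[OF this qp]
    show "0 < poly (pderiv (?p (Suc (Suc m)))) y * poly (?p m) y" .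
  next
    show "degree (?p m) \<le> degree (?p (Suc (Suc m)))" unfolding p(2) by simp
    show "real_simple_zeros (?p (Suc (Suc m)))" by (rule conjunct1[OF pq])
    show "?p m \<noteq> 0" by (rule p(1))
  qed
  \<comment> \<open>The zeros of \<open>?q (Suc (Suc m))\<close> are reached through
    \<open>?p\<close> of index one higher, its companion in \<open>pq\<close>.\<close>
  have "degree (?q (Suc (Suc m))) \<le> degree (?p (Suc (Suc (Suc m))))"
    unfolding p(2) q(2) by (rule div_le_mono) simp
  note swap = interlacing_swap[OF conjunct1[OF pq] q(1) this]
  have s: "real_simple_zeros (?q (Suc (Suc m)))"
    "\<And>z. poly (?q (Suc (Suc m))) z = 0 \<Longrightarrow> poly (pderiv (?q (Suc (Suc m)))) z * poly (?p (Suc (Suc (Suc m)))) z < 0"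
    by (rule swap, erule conjunct2[OF pq, rule_format])+
  show "interlace (?q (Suc (Suc m))) (?q m)"
  proof (rule interlaceI)
    fix y assume y: "poly (?q (Suc (Suc m))) y = 0"
    \<comment> \<open>Now \<open>G\<close> vanishes at the upper index \<open>m + 3\<close>, so the
      two-step inequality from \<open>m + 1\<close> keeps only the product of \<open>?p\<close> at
      \<open>m + 3\<close> with \<open>?q m\<close>.\<close>
    have "0 < \<kappa> m * - (poly (?p (Suc (Suc (Suc m)))) y * poly (?q m) y)"
      using phase(2)[OF q(3)[OF y], of "Suc m"] y by (simp add: G mult_ac)
    from zero_less_mult_pos[OF this \<kappa>] have "poly (?p (Suc (Suc (Suc m)))) y * poly (?q m) y < 0"
      by (simp only: neg_0_less_iff_less)
    with s(2)[OF y] show "0 < poly (pderiv (?q (Suc (Suc m)))) y * poly (?q m) y"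
      by (rule product_sign_trans(3))
  next
    show "degree (?q m) \<le> degree (?q (Suc (Suc m)))" unfolding q(2) by simp
    show "real_simple_zeros (?q (Suc (Suc m)))" by (rule s(1))
    show "?q m \<noteq> 0" by (rule q(1))
  qed
qed

theorem theorem10:
  fixes \<alpha> \<beta> :: real and n :: nat
  assumes "-1 < \<alpha>" and "\<alpha> < 0" and "0 < \<beta>" and "n \<ge> 5"
  shows "interlace (phi n (\<alpha>+1) (\<beta>+1)) (phi (n-2) (\<alpha>+1) (\<beta>+1)) \<and>
         interlace (phi n \<alpha> \<beta>) (phi (n-2) \<alpha> \<beta>)"
proof -
  from assms(4) have "Suc (Suc (n - 2)) = n" by simp
  with phi_interlacing[of \<alpha> \<beta> "n - 2"] assms show ?thesis by simp
qed

end
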